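(* Let $\sigma:\mathcal{E}\to\mathbb{R}$ be a sublinear function. Then, for $\lambda\in\mathbb{R}$, $\sigma$ is outer $\lambda$-smoothable if and only if $\lambda\ge w_\sigma$. In particular, for any target smoothness level $\beta>0$, a $\beta$-smooth convex function $f:\mathcal{E}\to\mathbb{R}$ is an optimal outer $\beta$-smoothing of $\sigma$ if and only if $[F^{\mathrm{out}}_\sigma]_{1/\beta}\le f\le[f^{\mathrm{out}}_\sigma]_{1/\beta}$ pointwise on $\mathcal{E}$.
   Context: $\mathcal{E}$ is a finite-dimensional Euclidean space with inner product $\langle\cdot,\cdot\rangle$ and induced norm $\|\cdot\|$. A function $\sigma:\mathcal{E}\to\mathbb{R}$ is sublinear if $\sigma(tx)=t\sigma(x)$ for all $t\ge 0$ and $\sigma(x+y)\le\sigma(x)+\sigma(y)$. A function $f:\mathcal{E}\to\mathbb{R}$ is $\beta$-smooth if it is differentiable with $\|\nabla f(x)-\nabla f(y)\|\le\beta\|x-y\|$ for all $x,y$. For $f,g:\mathcal{E}\to\mathbb{R}$, $\mathrm{dist}(f,g)=\sup_{x}|f(x)-g(x)|$ (possibly $+\infty$), and $f\le g$ is meant pointwise. For $\eta>0$, $[f]_\eta(x)=\eta f(x/\eta)$. The infimal convolution is $(f\,\square\,g)(x)=\inf_{y}f(y)+g(x-y)$. The epigraph is $\mathrm{epi}\,f=\{(x,\alpha)\in\mathcal{E}\times\mathbb{R}: f(x)\le\alpha\}$, and $\partial\sigma(0)$ is the convex subdifferential of $\sigma$ at $0$. Outer smoothability: $\sigma$ is outer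 $\lambda$-smoothable if for every $\beta>0$ there is a $\beta$-smooth convex $f:\mathcal{E}\to\mathbb{R}$ with $f\le\sigma$ and $\mathrm{dist}(f,\sigma)\le\lambda/\beta$. A convex $f:\mathcal{E}\to\mathbb{R}$ is an optimal outer $\beta$-smoothing of $\sigma$ if $f$ is $\beta$-smooth, $f\le\sigma$, and $\mathrm{dist}(\sigma,f)\le\mathrm{dist}(\sigma,\tilde f)$ for all $\beta$-smooth convex $\tilde f:\mathcal{E}\to\mathbb{R}$ with $\tilde f\le\sigma$. Core, center, width: $C_\sigma=\{(x,r)\in\mathcal{E}\times\mathbb{R}: (x,r)+\mathrm{epi}\,\tfrac12\|\cdot\|^2\subseteq\mathrm{epi}\,\sigma\}$; $(x_\sigma,r_\sigma)$ is the (unique) minimizer of $r+\tfrac12\|x\|^2$ over $(x,r)\in C_\sigma$; $w_\sigma=r_\sigma+\tfrac12\|x_\sigma\|^2$; and $\varrho_\sigma(x)=\max_{\zeta\in\partial\sigma(0)}\langle\zeta,x\rangle+\tfrac12\|\zeta\|^2$. Extremal smoothings: $f^{\mathrm{out}}_\sigma=\big[(r_\sigma+\sigma(\cdot-x_\sigma))\,\square\,\tfrac12\|\cdot\|^2\big]-w_\sigma$ and $F^{\mathrm{out}}_\sigma=\big[\varrho_\sigma\,\square\,\tfrac12\|\cdot\|^2\big]-w_\sigma$. *)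

theory Defs
  imports "HOL-Analysis.Analysis"
begin

definition sublinear :: "('a::real_vector \<Rightarrow> real) \<Rightarrow> bool" where
  "sublinear \<sigma> \<longleftrightarrow>
     (\<forall>t\<ge>0. \<forall>x. \<sigma> (t *\<^sub>R x) = t * \<sigma> x) \<and> (\<forall>x y. \<sigma> (x + y) \<le> \<sigma> x + \<sigma> y)"

definition smooth_fun :: "real \<Rightarrow> ('a::real_inner \<Rightarrow> real) \<Rightarrow> bool" where
  "smooth_fun \<beta> f \<longleftrightarrow>
     (\<exists>grad. (\<forall>x. GDERIV f x :> grad x) \<and>
             (\<forall>x y. norm (grad x - grad y) \<le> \<beta> * norm (x - y)))"

(* The supremum is taken in the extended reals, so that it may be infinite. *)
definition fun_dist :: "('a \<Rightarrow> real) \<Rightarrow> ('a \<Rightarrow> real) \<Rightarrow> ereal" where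
  "fun_dist f g = (SUP x. ereal \<bar>f x - g x\<bar>)"

definition rescale :: "real \<Rightarrow> ('a::real_vector \<Rightarrow> real) \<Rightarrow> 'a \<Rightarrow> real" where
  "rescale \<eta> f x = \<eta> * f (x /\<^sub>R \<eta>)"

(* This is a real infimum, meaningful only when the set of values is bounded below.
   That holds below, where f is a finite convex function (hence has an affine minorant)
   and g is half the squared norm. *)
definition inf_conv :: "('a::real_vector \<Rightarrow> real) \<Rightarrow> ('a \<Rightarrow> real) \<Rightarrow> 'a \<Rightarrow> real" where
  "inf_conv f g x = (INF y. f y + g (x - y))"

definition half_sq_norm :: "'a::real_normed_vector \<Rightarrow> real" where
  "half_sq_norm x = (norm x)\<^sup>2 / 2"

definition subdifferential :: "('a::real_inner \<Rightarrow> real) \<Rightarrow> 'a \<Rightarrow> 'a set" where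
  "subdifferential f x = {\<zeta>. \<forall>y. f y \<ge> f x + \<zeta> \<bullet> (y - x)}"

definition outer_smoothable :: "real \<Rightarrow> ('a::real_inner \<Rightarrow> real) \<Rightarrow> bool" where
  "outer_smoothable l \<sigma> \<longleftrightarrow>
     (\<forall>\<beta>>0. \<exists>f. smooth_fun \<beta> f \<and> convex_on UNIV f \<and> (\<forall>x. f x \<le> \<sigma> x) \<and>
               fun_dist f \<sigma> \<le> ereal (l / \<beta>))"

definition optimal_outer_smoothing ::
    "real \<Rightarrow> ('a::real_inner \<Rightarrow> real) \<Rightarrow> ('a \<Rightarrow> real) \<Rightarrow> bool" where
  "optimal_outer_smoothing \<beta> \<sigma> f \<longleftrightarrow>
     convex_on UNIV f \<and> smooth_fun \<beta> f \<and> (\<forall>x. f x \<le> \<sigma> x) \<and>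
     (\<forall>f'. smooth_fun \<beta> f' \<and> convex_on UNIV f' \<and> (\<forall>x. f' x \<le> \<sigma> x) \<longrightarrow>
           fun_dist \<sigma> f \<le> fun_dist \<sigma> f')"

definition core :: "('a::real_inner \<Rightarrow> real) \<Rightarrow> ('a \<times> real) set" where
  "core \<sigma> = {p. (\<lambda>q. p + q) ` epigraph UNIV half_sq_norm \<subseteq> epigraph UNIV \<sigma>}"

(* For sublinear \<sigma> on a Euclidean space the minimizer exists and is unique,
   so the definite description is meaningful. *)
definition center :: "('a::real_inner \<Rightarrow> real) \<Rightarrow> 'a \<times> real" where
  "center \<sigma> = (THE p. is_arg_min (\<lambda>(x, r). r + half_sq_norm x) (\<lambda>p. p \<in> core \<sigma>) p)"

definition center_x :: "('a::real_inner \<Rightarrow> real) \<Rightarrow> 'a" where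
  "center_x \<sigma> = fst (center \<sigma>)"

definition center_r :: "('a::real_inner \<Rightarrow> real) \<Rightarrow> real" where
  "center_r \<sigma> = snd (center \<sigma>)"

definition width :: "('a::real_inner \<Rightarrow> real) \<Rightarrow> real" where
  "width \<sigma> = center_r \<sigma> + half_sq_norm (center_x \<sigma>)"

(* For sublinear \<sigma> on a Euclidean space the subdifferential at 0 is nonempty and
   compact, so this supremum is a maximum. *)
definition rho :: "('a::real_inner \<Rightarrow> real) \<Rightarrow> 'a \<Rightarrow> real" where
  "rho \<sigma> x = (SUP \<zeta>\<in>subdifferential \<sigma> 0. \<zeta> \<bullet> x + half_sq_norm \<zeta>)"

definition f_out :: "('a::real_inner \<Rightarrow> real) \<Rightarrow> 'a \<Rightarrow> real" where
  "f_out \<sigma> x =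
     inf_conv (\<lambda>y. center_r \<sigma> + \<sigma> (y - center_x \<sigma>)) half_sq_norm x - width \<sigma>"

definition F_out :: "('a::real_inner \<Rightarrow> real) \<Rightarrow> 'a \<Rightarrow> real" where
  "F_out \<sigma> x = inf_conv (rho \<sigma>) half_sq_norm x - width \<sigma>"

end

theory Submission
  imports Defs
begin

text \<open>
  Write \<open>h\<close> for half the squared norm and \<open>S\<close> for the subdifferential of \<open>\<sigma>\<close> at the origin. Rescaling
  by \<open>\<beta>\<close> fixes \<open>\<sigma>\<close>, turns \<open>\<beta>\<close>-smooth minorants into \<open>1\<close>-smooth ones and multiplies
  distances by \<open>\<beta>\<close>, so everything reduces to \<open>\<beta> = 1\<close>. The core then has a direct meaning:
  \<open>(a, r)\<close> lies in it iff \<open>\<sigma> (a + z) \<le> r + h z\<close> for all \<open>z\<close> (\<open>core_iff\<close>), i.e. iff the unit parabola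
  with vertex \<open>(a, r)\<close> lies above \<open>\<sigma>\<close>. Its value at the origin is \<open>r + h a\<close>, so the width is the lowest
  height at which a unit parabola lying above \<open>\<sigma>\<close> can cross the vertical axis, and the center
  is the unique vertex attaining it.

  Lower bound on the error: a \<open>1\<close>-smooth \<open>f \<le> \<sigma>\<close> lies below the parabola that touches it at the origin.
  If \<open>\<sigma> - l \<le> f\<close>, raising that parabola by \<open>l\<close> gives one above \<open>\<sigma>\<close>, with crossing height at most
  \<open>l\<close>; hence \<open>width \<sigma> \<le> l\<close> (\<open>width_le_gap\<close>). When \<open>l\<close> is the width, uniqueness of the center moreover
  identifies the gradient of \<open>f\<close> at the origin as \<open>- center_x \<sigma>\<close>.

  The bound is attained by \<open>f_out \<sigma>\<close>, which is \<open>1\<close>-smooth as the Moreau envelope of a convex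
  function, and which stays within \<open>width \<sigma>\<close> below \<open>\<sigma>\<close> because the center lies in the core. So
  optimality of \<open>f\<close> means exactly \<open>\<sigma> - width \<sigma> \<le> f \<le> \<sigma>\<close>, and it remains to compare this with the
  two extremal functions. In one direction, \<open>f_out \<sigma> \<le> \<sigma>\<close> and \<open>\<sigma> - width \<sigma> \<le> F_out \<sigma>\<close>. In the other:

  \<^item> \<open>f \<le> f_out \<sigma>\<close> (\<open>optimal_gap_le_f_out\<close>) is cocoercivity of the gradient between \<open>x\<close> and the
    origin, once the gradient at the origin is known.
  \<^item> \<open>F_out \<sigma> \<le> f\<close> (\<open>optimal_gap_ge_F_out\<close>) follows by inserting the gradient step
    \<open>y = x - grad x\<close> into the infimal convolution and applying the descent inequality at \<open>x\<close>.

  The inequality \<open>\<sigma> - width \<sigma> \<le> F_out \<sigma>\<close> needs \<open>\<sigma>\<close> to be the support function of \<open>S\<close>. The smoothing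
  just constructed provides it: its gradients lie in \<open>S\<close>, and those far out along a ray
  are asymptotically active in that direction (\<open>sublinear_le_if_subgradients_le\<close>).
\<close>

section \<open>Minimizers and gradient inequalities\<close>

lemma continuous_attains_inf_bounded_sublevel:
  fixes F :: "'b::heine_borel \<Rightarrow> real"
  assumes "closed S" "continuous_on UNIV F" "x0 \<in> S" "bounded {x \<in> S. F x \<le> F x0}"
  obtains p where "p \<in> S" "\<And>x. x \<in> S \<Longrightarrow> F p \<le> F x"
proof -
  define T where "T = {x \<in> S. F x \<le> F x0}"
  have "closed {x. F x \<le> F x0}"
    using assms(2) by (intro closed_Collect_le continuous_intros)
  then have "closed T"
    using assms(1) by (simp add: T_def Collect_conj_eq closed_Int)
  then have "compact T"
    using assms(4) by (simp add: T_def compact_eq_bounded_closed)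
  moreover have "T \<noteq> {}" using assms(3) by (auto simp: T_def)
  moreover have "continuous_on T F"
    using continuous_on_subset[OF assms(2)] by simp
  ultimately have "\<exists>p\<in>T. \<forall>x\<in>T. F p \<le> F x"
    by (rule continuous_attains_inf)
  then obtain p where p: "p \<in> T" "\<forall>x\<in>T. F p \<le> F x" ..
  show thesis
  proof
    show "p \<in> S" using p by (simp add: T_def)
    show "F p \<le> F x" if "x \<in> S" for x
      using p that by (cases "F x \<le> F x0") (auto simp: T_def)
  qed
qed

text \<open>Coercivity of a quadratic against a linear term. It bounds the sublevel sets in the existence proofs
  for the center and for proximal points.\<close>

lemma bound_from_quadratic:
  fixes u L K :: real
  assumes "u\<^sup>2 / 2 \<le> L * u + K" "0 \<le> L" "0 \<le> K"
  shows "u \<le> 2 * L + 2 * K + 2"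
proof (rule ccontr)
  assume "\<not> ?thesis"
  then have u: "K + 1 \<le> u / 2 - L" "1 \<le> u" using assms(2,3) by linarith+
  have "1 * (K + 1) \<le> u * (u / 2 - L)"
    using u assms(3) by (intro mult_mono) auto
  then show False using assms(1) by (simp add: algebra_simps power2_eq_square)
qed

lemma inner_self_half_sq_norm: "x \<bullet> x = 2 * half_sq_norm x"
  by (simp add: half_sq_norm_def power2_norm_eq_inner)

lemma half_sq_norm_add: "half_sq_norm (x + y) = half_sq_norm x + x \<bullet> y + half_sq_norm y"
  unfolding half_sq_norm_def power2_norm_eq_inner
  by (simp add: inner_add_left inner_add_right inner_commute[of y x] field_simps)

lemma half_sq_norm_diff: "half_sq_norm (x - y) = half_sq_norm x - x \<bullet> y + half_sq_norm y"
  unfolding half_sq_norm_def power2_norm_eq_inner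
  by (simp add: inner_diff_left inner_diff_right inner_commute[of y x] field_simps)

lemma half_sq_norm_scaleR: "half_sq_norm (t *\<^sub>R x) = t\<^sup>2 * half_sq_norm x"
  by (simp add: half_sq_norm_def power_mult_distrib)

lemma half_sq_norm_minus: "half_sq_norm (- x) = half_sq_norm x"
  by (simp add: half_sq_norm_def)

lemmas half_sq_norm_expand = half_sq_norm_minus half_sq_norm_add half_sq_norm_diff half_sq_norm_scaleR
  inner_self_half_sq_norm inner_add_left inner_add_right inner_diff_left inner_diff_right

lemma half_sq_norm_nonneg: "0 \<le> half_sq_norm x"
  by (simp add: half_sq_norm_def)

lemma gderiv_along_line:
  fixes f :: "'a::real_inner \<Rightarrow> real"
  assumes "\<And>x. GDERIV f x :> grad x"
  shows "((\<lambda>t. f (x + t *\<^sub>R d)) has_real_derivative (grad (x + t *\<^sub>R d) \<bullet> d)) (at t)"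
proof -
  have "((\<lambda>t. x + t *\<^sub>R d) has_derivative (\<lambda>t. t *\<^sub>R d)) (at t)"
    by (auto intro!: derivative_eq_intros)
  moreover have "(f has_derivative (\<lambda>h. h \<bullet> grad (x + t *\<^sub>R d))) (at (x + t *\<^sub>R d))"
    using assms by (simp add: gderiv_def)
  ultimately have "((\<lambda>t. f (x + t *\<^sub>R d)) has_derivative (\<lambda>s. (s *\<^sub>R d) \<bullet> grad (x + t *\<^sub>R d))) (at t)"
    by (rule has_derivative_compose)
  then show ?thesis
    by (simp add: has_field_derivative_def inner_commute mult_commute_abs)
qed

lemma convex_above_tangent:
  fixes f :: "'a::real_inner \<Rightarrow> real"
  assumes "convex_on UNIV f" "\<And>x. GDERIV f x :> grad x"
  shows "f x + grad x \<bullet> (y - x) \<le> f y"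
proof -
  let ?\<phi> = "\<lambda>t. f (x + t *\<^sub>R (y - x))"
  have "convex_on UNIV ?\<phi>"
  proof (rule convex_onI)
    fix t a b :: real assume t: "0 < t" "t < 1"
    have "x + ((1 - t) *\<^sub>R a + t *\<^sub>R b) *\<^sub>R (y - x) =
          (1 - t) *\<^sub>R (x + a *\<^sub>R (y - x)) + t *\<^sub>R (x + b *\<^sub>R (y - x))"
      by (simp add: algebra_simps)
    then show "?\<phi> ((1 - t) *\<^sub>R a + t *\<^sub>R b) \<le> (1 - t) * ?\<phi> a + t * ?\<phi> b"
      using convex_onD[OF assms(1), of t] t by simp
  qed simp
  moreover have "(?\<phi> has_real_derivative (grad x \<bullet> (y - x))) (at 0)"
    using gderiv_along_line[OF assms(2), of x "y - x" 0] by simp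
  ultimately have "?\<phi> 1 - ?\<phi> 0 \<ge> (grad x \<bullet> (y - x)) * (1 - 0)"
    using convex_on_imp_above_tangent[of UNIV ?\<phi> 0 1] by auto
  then show ?thesis by simp
qed

text \<open>Along a segment, the function minus its quadratic model has nonpositive derivative, by
  Cauchy--Schwarz and the Lipschitz bound on the gradient.\<close>

lemma descent_inequality:
  fixes f :: "'a::real_inner \<Rightarrow> real"
  assumes "\<And>x. GDERIV f x :> grad x" "\<And>x y. norm (grad x - grad y) \<le> norm (x - y)"
  shows "f y \<le> f x + grad x \<bullet> (y - x) + half_sq_norm (y - x)"
proof -
  define d where "d = y - x"
  let ?\<phi> = "\<lambda>t. f (x + t *\<^sub>R d) - t * (grad x \<bullet> d) - t\<^sup>2 * half_sq_norm d"
  have deriv: "(?\<phi> has_real_derivative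
      ((grad (x + t *\<^sub>R d) - grad x) \<bullet> d - t * (norm d)\<^sup>2)) (at t)" for t
    by (auto intro!: derivative_eq_intros gderiv_along_line[OF assms(1)]
        simp: inner_diff_left half_sq_norm_def)
  have slope: "(grad (x + t *\<^sub>R d) - grad x) \<bullet> d - t * (norm d)\<^sup>2 \<le> 0" if "0 \<le> t" for t
  proof -
    have "(grad (x + t *\<^sub>R d) - grad x) \<bullet> d \<le> norm (grad (x + t *\<^sub>R d) - grad x) * norm d"
      by (rule norm_cauchy_schwarz)
    also have "\<dots> \<le> (t * norm d) * norm d"
      using assms(2)[of "x + t *\<^sub>R d" x] that by (intro mult_right_mono) auto
    finally show ?thesis by (simp add: power2_eq_square algebra_simps)
  qed
  have "\<exists>D. (?\<phi> has_real_derivative D) (at t) \<and> D \<le> 0" if "0 \<le> t" for t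
    using deriv[of t] slope[OF that] by blast
  then have "?\<phi> 1 \<le> ?\<phi> 0"
    by (intro DERIV_nonpos_imp_nonincreasing[of 0 1 ?\<phi>]) auto
  then show ?thesis by (simp add: d_def)
qed

text \<open>The tangent at \<open>y\<close> is a lower bound everywhere and the parabola at \<open>x\<close> an upper bound everywhere.
  Comparing them where their difference is smallest, one gradient step away from
  \<open>x\<close> for the function with the tangent at \<open>y\<close> subtracted, gives the squared gradient gap.\<close>

lemma cocoercivity:
  fixes f :: "'a::real_inner \<Rightarrow> real"
  assumes "convex_on UNIV f" "\<And>x. GDERIV f x :> grad x"
    "\<And>x y. norm (grad x - grad y) \<le> norm (x - y)"
  shows "f y + grad y \<bullet> (x - y) + half_sq_norm (grad x - grad y) \<le> f x"
proof -
  define z where "z = x - (grad x - grad y)"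
  have "f y + grad y \<bullet> (z - y) \<le> f x + grad x \<bullet> (z - x) + half_sq_norm (z - x)"
    using convex_above_tangent[OF assms(1,2), of y z] descent_inequality[OF assms(2,3), of z x]
    by linarith
  then show ?thesis
    by (simp add: z_def half_sq_norm_expand inner_commute)
qed

section \<open>Moreau envelopes\<close>

text \<open>
  First-order optimality of a proximal point: \<open>x - p\<close> is a subgradient of \<open>g\<close> at \<open>p\<close>. Minimality is
  compared along the segment from \<open>p\<close> to \<open>z\<close>, where the convex part varies at first order and the
  quadratic error only at second order in \<open>t\<close>.
\<close>

lemma prox_optimality:
  fixes g :: "'a::real_inner \<Rightarrow> real"
  assumes "convex_on UNIV g" and min: "\<And>z. g p + half_sq_norm (x - p) \<le> g z + half_sq_norm (x - z)"
  shows "g p + (x - p) \<bullet> (z - p) \<le> g z"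
proof -
  have bound: "g p + (x - p) \<bullet> (z - p) - t * half_sq_norm (z - p) \<le> g z" if t: "0 < t" "t < 1" for t
  proof -
    define q where "q = (1 - t) *\<^sub>R p + t *\<^sub>R z"
    have "g q \<le> (1 - t) * g p + t * g z"
      using convex_onD[OF assms(1), of t] t by (simp add: q_def)
    moreover have "half_sq_norm (x - q) =
        half_sq_norm (x - p) - t * ((x - p) \<bullet> (z - p)) + t * (t * half_sq_norm (z - p))"
    proof -
      have "x - q = (x - p) - t *\<^sub>R (z - p)" by (simp add: q_def algebra_simps)
      show ?thesis
        unfolding \<open>x - q = _\<close>
        by (simp add: half_sq_norm_diff[of "x - p"] half_sq_norm_scaleR power2_eq_square)
    qed
    ultimately have "t * (g p + (x - p) \<bullet> (z - p) - t * half_sq_norm (z - p)) \<le> t * g z"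
      using min[of q] by (simp add: algebra_simps)
    then show ?thesis using t by simp
  qed
  have "((\<lambda>t. g p + (x - p) \<bullet> (z - p) - t * half_sq_norm (z - p)) \<longlongrightarrow>
      g p + (x - p) \<bullet> (z - p) - 0 * half_sq_norm (z - p)) (at_right 0)"
    by (intro tendsto_intros)
  moreover have "\<forall>\<^sub>F t in at_right (0::real).
      g p + (x - p) \<bullet> (z - p) - t * half_sq_norm (z - p) \<le> g z"
    using bound by (auto simp: eventually_at_right[of 0 1] intro: exI[of _ 1])
  ultimately have "g p + (x - p) \<bullet> (z - p) - 0 * half_sq_norm (z - p) \<le> g z"
    by (rule tendsto_upperbound) simp
  then show ?thesis by simp
qed

lemma gderiv_if_quadratic_error:
  fixes f :: "'a::real_inner \<Rightarrow> real"
  assumes "\<And>y. \<bar>f y - f x - u \<bullet> (y - x)\<bar> \<le> half_sq_norm (y - x)"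
  shows "GDERIV f x :> u"
  unfolding gderiv_def has_derivative_within_alt2
proof (intro conjI allI impI)
  show "bounded_linear (\<lambda>h. h \<bullet> u)" by (rule bounded_linear_inner_left)
  fix e :: real assume e: "0 < e"
  show "\<forall>\<^sub>F y in at x. norm (f y - f x - (y - x) \<bullet> u) \<le> e * norm (y - x)"
    unfolding eventually_at
  proof (intro exI[of _ "2 * e"] conjI ballI impI)
    fix y assume "y \<noteq> x \<and> dist y x < 2 * e"
    then have "half_sq_norm (y - x) \<le> e * norm (y - x)"
      using mult_right_mono[of "norm (y - x)" "2 * e" "norm (y - x)"]
      by (simp add: half_sq_norm_def dist_norm power2_eq_square)
    then show "norm (f y - f x - (y - x) \<bullet> u) \<le> e * norm (y - x)"
      using assms[of y] by (simp add: inner_commute)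
  qed (use e in simp)
qed

lemma inf_conv_le:
  assumes "\<And>y. m \<le> f y + g (x - y)"
  shows "inf_conv f g x \<le> f y + g (x - y)"
  unfolding inf_conv_def using assms by (intro cINF_lower bdd_belowI2) auto

lemma inf_conv_ge:
  assumes "\<And>y. m \<le> f y + g (x - y)"
  shows "m \<le> inf_conv f g x"
  unfolding inf_conv_def using assms by (intro cINF_greatest) auto

text \<open>The envelope at \<open>x\<close> has gradient \<open>x - p x\<close>. The point \<open>p x\<close> is a competitor at \<open>y\<close>, which bounds the envelope
  above by a parabola; optimality of \<open>p x\<close> bounds it below by the tangent. The lower bounds give convexity, both
  together differentiability. Since the \<open>x - p x\<close> are subgradients of \<open>g\<close> at \<open>p x\<close>, they are monotone in
  \<open>p x\<close>, and this makes \<open>x - p x\<close> nonexpansive in \<open>x\<close>.\<close>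

lemma moreau_envelope_convex_smooth:
  fixes g :: "'a::real_inner \<Rightarrow> real"
  assumes "convex_on UNIV g"
    and "\<And>x z. g (p x) + half_sq_norm (x - p x) \<le> g z + half_sq_norm (x - z)"
  shows "convex_on UNIV (inf_conv g half_sq_norm)" "smooth_fun 1 (inf_conv g half_sq_norm)"
proof -
  let ?e = "inf_conv g half_sq_norm"
  note prox = prox_optimality[OF assms]
  have e_le: "?e x \<le> g z + half_sq_norm (x - z)" for x z
    using inf_conv_le[of _ g half_sq_norm x] assms(2) by blast
  have e_eq: "?e x = g (p x) + half_sq_norm (x - p x)" for x
    by (intro antisym e_le inf_conv_ge assms(2))
  have upper: "?e y \<le> ?e x + (x - p x) \<bullet> (y - x) + half_sq_norm (y - x)" for x y
    using e_le[of y "p x"] unfolding e_eq[of x]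
    by (simp add: half_sq_norm_expand inner_commute field_simps)
  have lower: "?e x + (x - p x) \<bullet> (y - x) \<le> ?e y" for x y
  proof -
    have "0 \<le> half_sq_norm ((y - p y) - (x - p x))" by (rule half_sq_norm_nonneg)
    then show ?thesis
      using prox[of x "p y"] unfolding e_eq
      by (simp add: half_sq_norm_expand inner_commute field_simps)
  qed
  show "convex_on UNIV ?e"
  proof (rule convex_onI)
    fix t :: real and x y :: 'a assume t: "0 < t" "t < 1"
    define m where "m = (1 - t) *\<^sub>R x + t *\<^sub>R y"
    have "(1 - t) * (?e m + (m - p m) \<bullet> (x - m)) + t * (?e m + (m - p m) \<bullet> (y - m))
        \<le> (1 - t) * ?e x + t * ?e y"
      using lower t by (intro add_mono mult_left_mono) auto
    moreover have "(1 - t) * ((m - p m) \<bullet> (x - m)) + t * ((m - p m) \<bullet> (y - m)) =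
        (m - p m) \<bullet> ((1 - t) *\<^sub>R (x - m) + t *\<^sub>R (y - m))"
      by (simp add: inner_add_right)
    moreover have "(1 - t) *\<^sub>R (x - m) + t *\<^sub>R (y - m) = 0"
      by (simp add: m_def algebra_simps)
    ultimately have "?e m \<le> (1 - t) * ?e x + t * ?e y"
      by (simp add: distrib_left left_diff_distrib)
    then show "?e ((1 - t) *\<^sub>R x + t *\<^sub>R y) \<le> (1 - t) * ?e x + t * ?e y"
      by (simp add: m_def)
  qed simp
  have "GDERIV ?e x :> (x - p x)" for x
  proof (rule gderiv_if_quadratic_error)
    show "\<bar>?e y - ?e x - (x - p x) \<bullet> (y - x)\<bar> \<le> half_sq_norm (y - x)" for y
      using upper[of y x] lower[of x y] half_sq_norm_nonneg[of "y - x"] by linarith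
  qed
  moreover have "norm ((x - p x) - (y - p y)) \<le> norm (x - y)" for x y
  proof -
    have "0 \<le> ((x - p x) - (y - p y)) \<bullet> (p x - p y)"
      using prox[of x "p y"] prox[of y "p x"] by (simp add: inner_diff_left inner_diff_right)
    moreover have "0 \<le> (p x - p y) \<bullet> (p x - p y)" by simp
    ultimately have "((x - p x) - (y - p y)) \<bullet> ((x - p x) - (y - p y)) \<le> (x - y) \<bullet> (x - y)"
      by (simp add: inner_diff_left inner_diff_right inner_commute)
    then show ?thesis by (simp add: norm_le)
  qed
  ultimately show "smooth_fun 1 ?e"
    unfolding smooth_fun_def by (intro exI[of _ "\<lambda>x. x - p x"]) auto
qed

section \<open>Sublinear functions\<close>

lemma sublinear_scale: "sublinear \<sigma> \<Longrightarrow> 0 \<le> t \<Longrightarrow> \<sigma> (t *\<^sub>R x) = t * \<sigma> x"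
  by (simp add: sublinear_def)

lemma sublinear_zero: "sublinear \<sigma> \<Longrightarrow> \<sigma> 0 = 0"
  using sublinear_scale[of \<sigma> 0 0] by simp

lemma sublinear_add: "sublinear \<sigma> \<Longrightarrow> \<sigma> (x + y) \<le> \<sigma> x + \<sigma> y"
  by (simp add: sublinear_def)

lemma sublinear_convex:
  assumes "sublinear \<sigma>"
  shows "convex_on UNIV \<sigma>"
proof (rule convex_onI)
  fix t :: real and x y assume "0 < t" "t < 1"
  then show "\<sigma> ((1 - t) *\<^sub>R x + t *\<^sub>R y) \<le> (1 - t) * \<sigma> x + t * \<sigma> y"
    using sublinear_add[OF assms, of "(1 - t) *\<^sub>R x" "t *\<^sub>R y"] sublinear_scale[OF assms] by simp
qed simp

lemma sublinear_continuous:
  fixes \<sigma> :: "'a::euclidean_space \<Rightarrow> real"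
  shows "sublinear \<sigma> \<Longrightarrow> continuous_on UNIV \<sigma>"
  by (simp add: convex_on_continuous sublinear_convex)

lemma sublinear_bound:
  fixes \<sigma> :: "'a::euclidean_space \<Rightarrow> real"
  assumes "sublinear \<sigma>"
  obtains L where "0 \<le> L" "\<And>x. \<bar>\<sigma> x\<bar> \<le> L * norm x"
proof -
  have "compact (\<sigma> ` sphere 0 1)"
    using continuous_on_subset[OF sublinear_continuous[OF assms]]
    by (intro compact_continuous_image) auto
  then have "bounded (\<sigma> ` sphere 0 1)" by (rule compact_imp_bounded)
  then obtain L where "\<forall>x\<in>sphere 0 1. \<bar>\<sigma> x\<bar> \<le> L" by (auto simp: bounded_iff)
  then have L: "\<bar>\<sigma> x\<bar> \<le> L" if "norm x = 1" for x using that by simp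
  have bound: "\<bar>\<sigma> x\<bar> \<le> L * norm x" for x
  proof (cases "x = 0")
    case False
    have "\<sigma> x = norm x * \<sigma> (x /\<^sub>R norm x)"
      using sublinear_scale[OF assms, of "norm x" "x /\<^sub>R norm x"] False by simp
    then have "\<bar>\<sigma> x\<bar> = norm x * \<bar>\<sigma> (x /\<^sub>R norm x)\<bar>" by (simp add: abs_mult)
    also have "\<dots> \<le> norm x * L" using False by (intro mult_left_mono L) auto
    finally show ?thesis by (simp add: mult.commute)
  qed (simp add: sublinear_zero[OF assms])
  obtain b :: 'a where b: "b \<in> Basis" using nonempty_Basis by blast
  have "0 \<le> L" using order_trans[OF abs_ge_zero L[of b]] b by simp
  then show thesis using bound by (rule that)
qed

section \<open>The core and its center\<close>

lemma core_iff: "(x, r) \<in> core \<sigma> \<longleftrightarrow> (\<forall>z. \<sigma> (x + z) \<le> r + half_sq_norm z)"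
proof -
  have "(x, r) \<in> core \<sigma> \<longleftrightarrow> (\<forall>z s. half_sq_norm z \<le> s \<longrightarrow> \<sigma> (x + z) \<le> r + s)"
    unfolding core_def epigraph_def image_subset_iff by simp
  also have "\<dots> \<longleftrightarrow> (\<forall>z. \<sigma> (x + z) \<le> r + half_sq_norm z)"
  proof (intro iffI allI impI)
    show "\<sigma> (x + z) \<le> r + half_sq_norm z"
      if "\<forall>z s. half_sq_norm z \<le> s \<longrightarrow> \<sigma> (x + z) \<le> r + s" for z
      using that by blast
    show "\<sigma> (x + z) \<le> r + s"
      if "\<forall>z. \<sigma> (x + z) \<le> r + half_sq_norm z" "half_sq_norm z \<le> s" for z s
      using that(1)[rule_format, of z] that(2) by linarith
  qed
  finally show ?thesis .
qed

text \<open>The midpoint of two core points lies in the core by convexity of \<open>\<sigma>\<close>, and strict convexity of the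
  squared norm gives it a strictly smaller value unless the points agree.\<close>

lemma core_value_unique:
  assumes "sublinear \<sigma>" "(x, r) \<in> core \<sigma>" "(y, s) \<in> core \<sigma>"
    and "r + half_sq_norm x = w" "s + half_sq_norm y = w"
    and min: "\<And>z t. (z, t) \<in> core \<sigma> \<Longrightarrow> w \<le> t + half_sq_norm z"
  shows "(x, r) = (y, s)"
proof -
  define m where "m = (1/2) *\<^sub>R x + (1/2) *\<^sub>R y"
  have "\<sigma> (m + z) \<le> (r + s) / 2 + half_sq_norm z" for z
  proof -
    have "m + z = (1/2) *\<^sub>R (x + z) + (1/2) *\<^sub>R (y + z)"
      using scaleR_left_distrib[of "1/2" "1/2" z] by (simp add: m_def scaleR_add_right)
    then have "\<sigma> (m + z) \<le> \<sigma> (x + z) / 2 + \<sigma> (y + z) / 2"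
      using convex_onD[OF sublinear_convex[OF assms(1)], of "1/2" "x + z" "y + z"] by simp
    moreover have "\<sigma> (x + z) \<le> r + half_sq_norm z" "\<sigma> (y + z) \<le> s + half_sq_norm z"
      using assms(2,3) by (simp_all add: core_iff)
    ultimately show ?thesis by (simp add: field_simps)
  qed
  then have "w \<le> (r + s) / 2 + half_sq_norm m" by (intro min) (simp add: core_iff)
  moreover have "half_sq_norm m = (half_sq_norm x + half_sq_norm y) / 2 - half_sq_norm (x - y) / 4"
    by (simp add: m_def half_sq_norm_expand inner_commute field_simps)
  ultimately have "half_sq_norm (x - y) \<le> 0" using assms(4,5) by (simp add: field_simps)
  then have "x = y" by (simp add: half_sq_norm_def)
  then show ?thesis using assms(4,5) by simp
qed

text \<open>The core is closed, and nonempty because \<open>\<sigma>\<close> grows at most linearly. At \<open>z = 0\<close> membership reads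
  \<open>\<sigma> x \<le> r\<close>, so \<open>r\<close> decreases at most linearly in \<open>x\<close> and the quadratic term bounds the sublevel set.\<close>

lemma core_minimizer_exists:
  fixes \<sigma> :: "'a::euclidean_space \<Rightarrow> real"
  assumes "sublinear \<sigma>"
  shows "\<exists>p\<in>core \<sigma>. \<forall>q\<in>core \<sigma>. snd p + half_sq_norm (fst p) \<le> snd q + half_sq_norm (fst q)"
proof -
  obtain L where L: "0 \<le> L" "\<And>x. \<bar>\<sigma> x\<bar> \<le> L * norm x" using sublinear_bound[OF assms] by blast
  define F :: "'a \<times> real \<Rightarrow> real" where "F = (\<lambda>p. snd p + half_sq_norm (fst p))"
  have cont: "continuous_on UNIV F"
    unfolding F_def half_sq_norm_def by (intro continuous_intros) auto
  have "core \<sigma> = (\<Inter>z. {p. \<sigma> (fst p + z) \<le> snd p + half_sq_norm z})"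
    by (auto simp: core_iff)
  moreover have "closed {p. \<sigma> (fst p + z) \<le> snd p + half_sq_norm z}" for z
    by (intro closed_Collect_le continuous_intros
        continuous_on_compose2[OF sublinear_continuous[OF assms]]) auto
  ultimately have closed: "closed (core \<sigma>)" by (simp add: closed_INT)
  \<comment> \<open>The height comes from completing the square: \<open>L * u \<le> L\<^sup>2 / 2 + u\<^sup>2 / 2\<close>.\<close>
  have mem: "(0, L\<^sup>2 / 2) \<in> core \<sigma>"
    unfolding core_iff
  proof
    fix z
    have "\<sigma> z \<le> L * norm z" using L(2)[of z] by linarith
    also have "\<dots> \<le> L\<^sup>2 / 2 + half_sq_norm z"
      using zero_le_power2[of "L - norm z"] by (simp add: half_sq_norm_def power2_diff)
    finally show "\<sigma> (0 + z) \<le> L\<^sup>2 / 2 + half_sq_norm z" by simp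
  qed
  define K where "K = L\<^sup>2 / 2"
  define B where "B = 2 * L + 2 * K + 2"
  have "0 \<le> K" by (simp add: K_def)
  have sublevel: "norm x \<le> B \<and> \<bar>r\<bar> \<le> L * B + K" if "(x, r) \<in> core \<sigma>" "r + half_sq_norm x \<le> K" for x r
  proof -
    have "\<sigma> x \<le> r" using that(1) core_iff[of x r \<sigma>] by (auto dest!: spec[of _ 0] simp: half_sq_norm_def)
    then have r: "- (L * norm x) \<le> r" using L(2)[of x] by linarith
    then have "(norm x)\<^sup>2 / 2 \<le> L * norm x + K" using that(2) by (simp add: half_sq_norm_def)
    then have B: "norm x \<le> B" unfolding B_def using L(1) \<open>0 \<le> K\<close> by (rule bound_from_quadratic)
    then have "L * norm x \<le> L * B" using L(1) by (rule mult_left_mono)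
    moreover have "0 \<le> L * B" using B L(1) norm_ge_zero[of x] by (intro mult_nonneg_nonneg) linarith+
    ultimately show ?thesis
      using B r that(2) half_sq_norm_nonneg[of x] \<open>0 \<le> K\<close> by linarith
  qed
  have "bounded {p \<in> core \<sigma>. F p \<le> F (0, L\<^sup>2 / 2)}"
  proof (rule bounded_subset)
    show "bounded (cball (0::'a) B \<times> cball (0::real) (L * B + K))"
      by (intro bounded_Times bounded_cball)
    show "{p \<in> core \<sigma>. F p \<le> F (0, L\<^sup>2 / 2)} \<subseteq> cball 0 B \<times> cball 0 (L * B + K)"
      using sublevel by (auto simp: F_def half_sq_norm_def K_def)
  qed
  then obtain p where "p \<in> core \<sigma>" "\<And>q. q \<in> core \<sigma> \<Longrightarrow> F p \<le> F q"
    using continuous_attains_inf_bounded_sublevel[OF closed cont mem] by metis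
  then show ?thesis unfolding F_def by blast
qed

lemma
  fixes \<sigma> :: "'a::euclidean_space \<Rightarrow> real"
  assumes "sublinear \<sigma>"
  shows center_in_core: "(center_x \<sigma>, center_r \<sigma>) \<in> core \<sigma>"
    and width_le_core_value: "\<And>x r. (x, r) \<in> core \<sigma> \<Longrightarrow> width \<sigma> \<le> r + half_sq_norm x"
    and core_value_eq_width: "\<And>x r. (x, r) \<in> core \<sigma> \<Longrightarrow> r + half_sq_norm x = width \<sigma> \<Longrightarrow> x = center_x \<sigma>"
proof -
  obtain p where "p \<in> core \<sigma>" and
    p: "\<And>q. q \<in> core \<sigma> \<Longrightarrow> snd p + half_sq_norm (fst p) \<le> snd q + half_sq_norm (fst q)"
    using core_minimizer_exists[OF assms] by blast
  define x0 r0 where "x0 = fst p" and "r0 = snd p"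
  have in_core: "(x0, r0) \<in> core \<sigma>" using \<open>p \<in> core \<sigma>\<close> by (simp add: x0_def r0_def)
  have min: "r0 + half_sq_norm x0 \<le> s + half_sq_norm y" if "(y, s) \<in> core \<sigma>" for y s
    using p[OF that] by (simp add: x0_def r0_def)
  have uniq: "(x, r) = (x0, r0)" if "(x, r) \<in> core \<sigma>" "r + half_sq_norm x = r0 + half_sq_norm x0" for x r
    using core_value_unique[OF assms that(1) in_core that(2) refl min] .
  have "center \<sigma> = (x0, r0)"
    unfolding center_def
  proof (rule the_equality)
    show "is_arg_min (\<lambda>(x, r). r + half_sq_norm x) (\<lambda>p. p \<in> core \<sigma>) (x0, r0)"
      using in_core min by (auto simp: is_arg_min_def not_less)
    fix p assume p: "is_arg_min (\<lambda>(x, r). r + half_sq_norm x) (\<lambda>p. p \<in> core \<sigma>) p"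
    obtain x r where xr: "p = (x, r)" by (cases p)
    have mem: "(x, r) \<in> core \<sigma>" and "\<not> r0 + half_sq_norm x0 < r + half_sq_norm x"
      using p in_core xr by (auto simp: is_arg_min_def)
    then have "r + half_sq_norm x = r0 + half_sq_norm x0" using min[OF mem] by linarith
    then show "p = (x0, r0)" using uniq[OF mem] xr by blast
  qed
  then have eq: "center_x \<sigma> = x0" "center_r \<sigma> = r0" "width \<sigma> = r0 + half_sq_norm x0"
    by (simp_all add: center_x_def center_r_def width_def)
  show "(center_x \<sigma>, center_r \<sigma>) \<in> core \<sigma>" using in_core eq by simp
  show "width \<sigma> \<le> r + half_sq_norm x" if "(x, r) \<in> core \<sigma>" for x r using min that eq by simp
  show "x = center_x \<sigma>" if "(x, r) \<in> core \<sigma>" "r + half_sq_norm x = width \<sigma>" for x r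
    using uniq[of x r] that eq by simp
qed

section \<open>The largest optimal smoothing\<close>

text \<open>Subadditivity splits off the increment that starts at the center, and core membership bounds its
  value by the parabola there.\<close>

lemma f_out_integrand_ge:
  fixes \<sigma> :: "'a::euclidean_space \<Rightarrow> real"
  assumes "sublinear \<sigma>"
  shows "\<sigma> x \<le> center_r \<sigma> + \<sigma> (y - center_x \<sigma>) + half_sq_norm (x - y)"
proof -
  have "\<sigma> x = \<sigma> ((y - center_x \<sigma>) + (center_x \<sigma> + (x - y)))" by simp
  also have "\<dots> \<le> \<sigma> (y - center_x \<sigma>) + \<sigma> (center_x \<sigma> + (x - y))"
    by (rule sublinear_add[OF assms])
  also have "\<sigma> (center_x \<sigma> + (x - y)) \<le> center_r \<sigma> + half_sq_norm (x - y)"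
    using center_in_core[OF assms] by (simp add: core_iff)
  finally show ?thesis by simp
qed

lemma f_out_ge:
  fixes \<sigma> :: "'a::euclidean_space \<Rightarrow> real"
  assumes "sublinear \<sigma>"
  shows "\<sigma> x - width \<sigma> \<le> f_out \<sigma> x"
proof -
  have "\<sigma> x \<le> inf_conv (\<lambda>y. center_r \<sigma> + \<sigma> (y - center_x \<sigma>)) half_sq_norm x"
    by (rule inf_conv_ge) (rule f_out_integrand_ge[OF assms])
  then show ?thesis by (simp add: f_out_def)
qed

text \<open>At \<open>y = x + center_x \<sigma>\<close> the shift cancels, and the value is \<open>\<sigma> x + width \<sigma>\<close>.\<close>

lemma f_out_le:
  fixes \<sigma> :: "'a::euclidean_space \<Rightarrow> real"
  assumes "sublinear \<sigma>"
  shows "f_out \<sigma> x \<le> \<sigma> x"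
proof -
  let ?g = "\<lambda>y. center_r \<sigma> + \<sigma> (y - center_x \<sigma>)"
  have "inf_conv ?g half_sq_norm x \<le> ?g (x + center_x \<sigma>) + half_sq_norm (x - (x + center_x \<sigma>))"
    by (rule inf_conv_le[of "\<sigma> x" ?g half_sq_norm x]) (rule f_out_integrand_ge[OF assms])
  then show ?thesis by (simp add: f_out_def width_def half_sq_norm_minus)
qed

lemma f_out_convex_smooth:
  fixes \<sigma> :: "'a::euclidean_space \<Rightarrow> real"
  assumes "sublinear \<sigma>"
  shows "convex_on UNIV (f_out \<sigma>)" "smooth_fun 1 (f_out \<sigma>)"
proof -
  define a where "a = center_x \<sigma>"
  define g where "g = (\<lambda>y. center_r \<sigma> + \<sigma> (y - a))"
  obtain L where L: "0 \<le> L" "\<And>x. \<bar>\<sigma> x\<bar> \<le> L * norm x" using sublinear_bound[OF assms] by blast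
  have g_convex: "convex_on UNIV g"
  proof (rule convex_onI)
    fix t :: real and x y :: 'a assume t: "0 < t" "t < 1"
    have "(1 - t) *\<^sub>R x + t *\<^sub>R y - a = (1 - t) *\<^sub>R (x - a) + t *\<^sub>R (y - a)"
      by (simp add: algebra_simps)
    then have "\<sigma> ((1 - t) *\<^sub>R x + t *\<^sub>R y - a) \<le> (1 - t) * \<sigma> (x - a) + t * \<sigma> (y - a)"
      using convex_onD[OF sublinear_convex[OF assms], of t] t by simp
    then show "g ((1 - t) *\<^sub>R x + t *\<^sub>R y) \<le> (1 - t) * g x + t * g y"
      by (simp add: g_def algebra_simps)
  qed simp
  have "\<exists>p. \<forall>z. g p + half_sq_norm (x - p) \<le> g z + half_sq_norm (x - z)" for x
  proof -
    define F where "F = (\<lambda>z. g z + half_sq_norm (x - z))"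
    have cont: "continuous_on UNIV F"
      unfolding F_def g_def half_sq_norm_def
      by (intro continuous_intros continuous_on_compose2[OF sublinear_continuous[OF assms]]) auto
    \<comment> \<open>\<open>L * norm (x - a)\<close> pays for measuring the distance of \<open>z\<close> from \<open>x\<close> instead of from \<open>a\<close>.\<close>
    define K where "K = L * norm (x - a) + \<bar>F x - center_r \<sigma>\<bar>"
    have "0 \<le> K" using L(1) by (simp add: K_def)
    have "norm (z - x) \<le> 2 * L + 2 * K + 2" if "F z \<le> F x" for z
    proof (rule bound_from_quadratic[OF _ L(1) \<open>0 \<le> K\<close>])
      have "norm (z - a) \<le> norm (z - x) + norm (x - a)"
        using norm_triangle_ineq[of "z - x" "x - a"] by simp
      then have "L * norm (z - a) \<le> L * norm (z - x) + L * norm (x - a)"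
        using mult_left_mono[OF _ L(1)] by (fastforce simp: distrib_left)
      moreover have "- (L * norm (z - a)) \<le> \<sigma> (z - a)" using L(2)[of "z - a"] by linarith
      ultimately show "(norm (z - x))\<^sup>2 / 2 \<le> L * norm (z - x) + K"
        using that by (simp add: K_def F_def g_def half_sq_norm_def norm_minus_commute)
    qed
    then have "bounded {z \<in> UNIV. F z \<le> F x}"
      unfolding bounded_def by (intro exI[of _ x]) (auto simp: dist_norm norm_minus_commute)
    then show ?thesis
      using continuous_attains_inf_bounded_sublevel[OF closed_UNIV cont, of x]
      unfolding F_def by (metis UNIV_I)
  qed
  then obtain p where "\<And>x z. g (p x) + half_sq_norm (x - p x) \<le> g z + half_sq_norm (x - z)"
    by metis
  note env = moreau_envelope_convex_smooth[OF g_convex this]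
  have eq: "f_out \<sigma> = (\<lambda>x. inf_conv g half_sq_norm x - width \<sigma>)"
    by (simp add: f_out_def g_def a_def fun_eq_iff)
  show "convex_on UNIV (f_out \<sigma>)"
    unfolding eq
  proof (rule convex_onI)
    fix t :: real and x y :: 'a assume "0 < t" "t < 1"
    then show "inf_conv g half_sq_norm ((1 - t) *\<^sub>R x + t *\<^sub>R y) - width \<sigma>
        \<le> (1 - t) * (inf_conv g half_sq_norm x - width \<sigma>) + t * (inf_conv g half_sq_norm y - width \<sigma>)"
      using convex_onD[OF env(1), of t x y] by (simp add: algebra_simps)
  qed simp
  show "smooth_fun 1 (f_out \<sigma>)"
    using env(2) unfolding eq smooth_fun_def gderiv_def
    by (auto intro!: derivative_eq_intros)
qed

section \<open>Smooth convex minorants\<close>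

text \<open>The tangent at \<open>x\<close> stays below \<open>\<sigma>\<close>. Evaluated at \<open>t y\<close> and divided by \<open>t\<close>, its constant term vanishes in the
  limit, whereas \<open>\<sigma>\<close> is unchanged by homogeneity.\<close>

lemma gradient_of_minorant_in_subdifferential:
  assumes "sublinear \<sigma>" "convex_on UNIV f" "\<And>x. GDERIV f x :> grad x" "\<And>x. f x \<le> \<sigma> x"
  shows "grad x \<in> subdifferential \<sigma> 0"
  unfolding subdifferential_def
proof safe
  fix y
  have bound: "grad x \<bullet> y + (f x - grad x \<bullet> x) / t \<le> \<sigma> y" if "0 < t" for t
  proof -
    have "f x + grad x \<bullet> (t *\<^sub>R y - x) \<le> \<sigma> (t *\<^sub>R y)"
      using convex_above_tangent[OF assms(2,3)] assms(4) order_trans by blast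
    then show ?thesis
      using that sublinear_scale[OF assms(1), of t y] by (simp add: inner_diff_right field_simps)
  qed
  have "((\<lambda>t. grad x \<bullet> y + (f x - grad x \<bullet> x) / t) \<longlongrightarrow> grad x \<bullet> y + 0) at_top"
    by (intro tendsto_intros tendsto_divide_0[OF tendsto_const] filterlim_at_top_imp_at_infinity
        filterlim_ident)
  moreover have "\<forall>\<^sub>F t in at_top. grad x \<bullet> y + (f x - grad x \<bullet> x) / t \<le> \<sigma> y"
    using eventually_gt_at_top[of 0] by eventually_elim (rule bound)
  ultimately have "grad x \<bullet> y + 0 \<le> \<sigma> y"
    by (rule tendsto_upperbound) simp
  then show "\<sigma> 0 + grad x \<bullet> (y - 0) \<le> \<sigma> y" by (simp add: sublinear_zero[OF assms(1)])
qed

text \<open>The parabola touching \<open>f\<close> at the origin lies above \<open>f\<close>, hence, raised by \<open>l\<close>, above \<open>\<sigma>\<close>.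
  Completing the square puts its vertex at \<open>- grad 0\<close>. The height is given
  with \<open>0\<close> in place of \<open>f 0 \<le> 0\<close>, so that the value of this core point is exactly \<open>l\<close>.\<close>

lemma gradient_at_zero_in_core:
  assumes "sublinear \<sigma>" "\<And>x. GDERIV f x :> grad x" "\<And>x y. norm (grad x - grad y) \<le> norm (x - y)"
    and "\<And>x. f x \<le> \<sigma> x" "\<And>x. \<sigma> x - l \<le> f x"
  shows "(- grad 0, l - half_sq_norm (grad 0)) \<in> core \<sigma>"
  unfolding core_iff
proof
  fix z
  have "f (z - grad 0) \<le> f 0 + grad 0 \<bullet> (z - grad 0) + half_sq_norm (z - grad 0)"
    using descent_inequality[OF assms(2,3), of "z - grad 0" 0] by simp
  moreover have "f 0 \<le> 0" using assms(4)[of 0] sublinear_zero[OF assms(1)] by simp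
  ultimately have "\<sigma> (z - grad 0) - l \<le> grad 0 \<bullet> (z - grad 0) + half_sq_norm (z - grad 0)"
    using assms(5)[of "z - grad 0"] by linarith
  then show "\<sigma> (- grad 0 + z) \<le> l - half_sq_norm (grad 0) + half_sq_norm z"
    by (simp add: half_sq_norm_expand inner_commute field_simps)
qed

lemma width_le_gap:
  fixes \<sigma> :: "'a::euclidean_space \<Rightarrow> real"
  assumes "sublinear \<sigma>" "smooth_fun 1 f" "\<And>x. f x \<le> \<sigma> x" "\<And>x. \<sigma> x - l \<le> f x"
  shows "width \<sigma> \<le> l"
proof -
  obtain grad where g: "\<And>x. GDERIV f x :> grad x" "\<And>x y. norm (grad x - grad y) \<le> norm (x - y)"
    using assms(2) by (auto simp: smooth_fun_def)
  show ?thesis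
    using width_le_core_value[OF assms(1) gradient_at_zero_in_core[OF assms(1) g assms(3,4)]]
    by (simp add: half_sq_norm_def)
qed

text \<open>The core point obtained from the gradient at the origin attains the width, so it is the center.
  Cocoercivity then bounds \<open>f x\<close> by \<open>\<zeta> \<bullet> x - h (\<zeta> + center_x \<sigma>)\<close> with \<open>\<zeta> = grad x\<close>. Since \<open>\<zeta>\<close> is a subgradient of
  \<open>\<sigma>\<close> at the origin, this is a lower bound for every value whose infimum is \<open>f_out \<sigma> x\<close>:
  it is the minimum of \<open>\<zeta> \<bullet> (y - center_x \<sigma>) + h (x - y)\<close> over \<open>y\<close>, plus the constant
  \<open>center_r \<sigma> - width \<sigma> = - h (center_x \<sigma>)\<close>.\<close>

lemma optimal_gap_le_f_out:
  fixes \<sigma> :: "'a::euclidean_space \<Rightarrow> real"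
  assumes "sublinear \<sigma>" "convex_on UNIV f" "smooth_fun 1 f"
    and "\<And>x. f x \<le> \<sigma> x" "\<And>x. \<sigma> x - width \<sigma> \<le> f x"
  shows "f x \<le> f_out \<sigma> x"
proof -
  obtain grad where g: "\<And>x. GDERIV f x :> grad x" "\<And>x y. norm (grad x - grad y) \<le> norm (x - y)"
    using assms(3) by (auto simp: smooth_fun_def)
  have center: "center_x \<sigma> = - grad 0"
    using core_value_eq_width[OF assms(1) gradient_at_zero_in_core[OF assms(1) g assms(4,5)]]
    by (simp add: half_sq_norm_def)
  have tangent: "f x \<le> grad x \<bullet> x - half_sq_norm (grad 0 - grad x)"
    using cocoercivity[OF assms(2) g, of x 0] assms(4)[of 0] sublinear_zero[OF assms(1)] by simp
  have "f x + width \<sigma> \<le> center_r \<sigma> + \<sigma> (y - center_x \<sigma>) + half_sq_norm (x - y)" for y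
  proof -
    have "grad x \<bullet> (y - center_x \<sigma>) \<le> \<sigma> (y - center_x \<sigma>)"
      using gradient_of_minorant_in_subdifferential[OF assms(1,2) g(1) assms(4), of x]
      by (simp add: subdifferential_def sublinear_zero[OF assms(1)])
    \<comment> \<open>The unconstrained minimum over \<open>y\<close> is at \<open>x - y = grad x\<close>; this is the square that remains.\<close>
    moreover have "0 \<le> half_sq_norm (grad x - (x - y))" by (rule half_sq_norm_nonneg)
    ultimately show ?thesis
      using tangent unfolding width_def center
      by (simp add: half_sq_norm_expand inner_commute field_simps)
  qed
  then have "f x + width \<sigma> \<le> inf_conv (\<lambda>y. center_r \<sigma> + \<sigma> (y - center_x \<sigma>)) half_sq_norm x"
    by (rule inf_conv_ge)
  then show ?thesis by (simp add: f_out_def)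
qed

section \<open>The smallest optimal smoothing\<close>

text \<open>A function at bounded distance below \<open>\<sigma>\<close> must grow like \<open>\<sigma>\<close> along the ray through \<open>x\<close>. For a smooth convex one the
  gradient \<open>\<zeta>\<close> at \<open>t x\<close> is a subgradient of \<open>\<sigma>\<close> at the origin, and by the tangent inequality between
  \<open>t x\<close> and the origin it accounts for this growth up to a constant: \<open>\<zeta> \<bullet> x \<ge> \<sigma> x - width \<sigma> / t\<close>.
  This is the support function representation of \<open>\<sigma>\<close>.\<close>

lemma sublinear_le_if_subgradients_le:
  fixes \<sigma> :: "'a::euclidean_space \<Rightarrow> real"
  assumes "sublinear \<sigma>" and le: "\<And>\<zeta>. \<zeta> \<in> subdifferential \<sigma> 0 \<Longrightarrow> \<zeta> \<bullet> x \<le> u"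
  shows "\<sigma> x \<le> u"
proof -
  obtain grad where g: "\<And>x. GDERIV (f_out \<sigma>) x :> grad x"
    using f_out_convex_smooth(2)[OF assms(1)] by (auto simp: smooth_fun_def)
  note cvx = f_out_convex_smooth(1)[OF assms(1)]
  have bound: "\<sigma> x - width \<sigma> / t \<le> u" if t: "0 < t" for t
  proof -
    let ?\<zeta> = "grad (t *\<^sub>R x)"
    have "?\<zeta> \<in> subdifferential \<sigma> 0"
      using gradient_of_minorant_in_subdifferential[OF assms(1) cvx g f_out_le[OF assms(1)]] .
    then have "t * (?\<zeta> \<bullet> x) \<le> t * u" using le t by simp
    moreover have "f_out \<sigma> (t *\<^sub>R x) - t * (?\<zeta> \<bullet> x) \<le> f_out \<sigma> 0"
      using convex_above_tangent[OF cvx g, of "t *\<^sub>R x" 0] by simp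
    moreover have "f_out \<sigma> 0 \<le> 0" "t * \<sigma> x - width \<sigma> \<le> f_out \<sigma> (t *\<^sub>R x)"
      using f_out_le[OF assms(1), of 0] f_out_ge[OF assms(1), of "t *\<^sub>R x"] t
        sublinear_zero[OF assms(1)] sublinear_scale[OF assms(1), of t x] by simp_all
    ultimately have "t * \<sigma> x - width \<sigma> \<le> t * u" by linarith
    then show ?thesis using t by (simp add: field_simps)
  qed
  have "((\<lambda>t. \<sigma> x - width \<sigma> / t) \<longlongrightarrow> \<sigma> x - 0) at_top"
    by (intro tendsto_intros tendsto_divide_0[OF tendsto_const] filterlim_at_top_imp_at_infinity
        filterlim_ident)
  moreover have "\<forall>\<^sub>F t in at_top. \<sigma> x - width \<sigma> / t \<le> u"
    using eventually_gt_at_top[of 0] by eventually_elim (rule bound)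
  ultimately have "\<sigma> x - 0 \<le> u"
    by (rule tendsto_upperbound) simp
  then show ?thesis by simp
qed

text \<open>If there were no subgradients, every \<open>u\<close> would bound them, also one below \<open>\<sigma> 0\<close>.\<close>

lemma subdifferential_nonempty:
  fixes \<sigma> :: "'a::euclidean_space \<Rightarrow> real"
  assumes "sublinear \<sigma>"
  shows "subdifferential \<sigma> 0 \<noteq> {}"
  using sublinear_le_if_subgradients_le[OF assms, of 0 "\<sigma> 0 - 1"] by auto

text \<open>Subgradients at the origin have norm at most the growth constant \<open>L\<close> of \<open>\<sigma>\<close>, so the supremum defining
  \<open>rho\<close> is over a set that is bounded above.\<close>

lemma rho_ge:
  fixes \<sigma> :: "'a::euclidean_space \<Rightarrow> real"
  assumes "sublinear \<sigma>" "\<zeta> \<in> subdifferential \<sigma> 0"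
  shows "\<zeta> \<bullet> x + half_sq_norm \<zeta> \<le> rho \<sigma> x"
  unfolding rho_def
proof (rule cSUP_upper[OF assms(2)])
  obtain L where L: "0 \<le> L" "\<And>x. \<bar>\<sigma> x\<bar> \<le> L * norm x" using sublinear_bound[OF assms(1)] by blast
  have "\<xi> \<bullet> x + half_sq_norm \<xi> \<le> L * norm x + L\<^sup>2 / 2" if "\<xi> \<in> subdifferential \<sigma> 0" for \<xi>
  proof -
    have sub: "\<xi> \<bullet> y \<le> L * norm y" for y
      using that L(2)[of y] by (auto simp: subdifferential_def sublinear_zero[OF assms(1)]
          dest!: spec[of _ y])
    have "norm \<xi> * norm \<xi> \<le> L * norm \<xi>"
      using sub[of \<xi>] by (simp add: norm_eq_sqrt_inner)
    then have "norm \<xi> \<le> L" using L(1) by (cases "\<xi> = 0") auto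
    then have "half_sq_norm \<xi> \<le> L\<^sup>2 / 2" by (simp add: half_sq_norm_def power_mono)
    then show ?thesis using sub[of x] by linarith
  qed
  then show "bdd_above ((\<lambda>\<zeta>. \<zeta> \<bullet> x + half_sq_norm \<zeta>) ` subdifferential \<sigma> 0)"
    by (rule bdd_aboveI2)
qed

text \<open>By the support function representation it suffices to bound \<open>\<zeta> \<bullet> x\<close> for a single subgradient \<open>\<zeta>\<close>, and then the
  slack is at least \<open>h (\<zeta> - (x - y))\<close>.\<close>

lemma F_out_integrand_ge:
  fixes \<sigma> :: "'a::euclidean_space \<Rightarrow> real"
  assumes "sublinear \<sigma>"
  shows "\<sigma> x \<le> rho \<sigma> y + half_sq_norm (x - y)"
proof (rule sublinear_le_if_subgradients_le[OF assms])
  fix \<zeta> assume "\<zeta> \<in> subdifferential \<sigma> 0"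
  then have "\<zeta> \<bullet> y + half_sq_norm \<zeta> \<le> rho \<sigma> y" by (rule rho_ge[OF assms])
  moreover have "0 \<le> half_sq_norm (\<zeta> - (x - y))" by (rule half_sq_norm_nonneg)
  ultimately show "\<zeta> \<bullet> x \<le> rho \<sigma> y + half_sq_norm (x - y)"
    by (simp add: half_sq_norm_expand inner_commute field_simps)
qed

lemma F_out_ge:
  fixes \<sigma> :: "'a::euclidean_space \<Rightarrow> real"
  assumes "sublinear \<sigma>"
  shows "\<sigma> x - width \<sigma> \<le> F_out \<sigma> x"
proof -
  have "\<sigma> x \<le> inf_conv (rho \<sigma>) half_sq_norm x"
    by (rule inf_conv_ge) (rule F_out_integrand_ge[OF assms])
  then show ?thesis by (simp add: F_out_def)
qed

text \<open>The gradient step \<open>x - grad x\<close> is used in the infimal convolution. For each subgradient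
  \<open>\<zeta>\<close>, the lower bound \<open>\<zeta> \<bullet> z - width \<sigma> \<le> f z\<close> and the parabola above \<open>f\<close> that touches it at \<open>x\<close> are
  compared at \<open>z = x + (\<zeta> - grad x)\<close>, where the parabola comes closest to the affine function; the squares then
  combine to the desired bound.\<close>

lemma optimal_gap_ge_F_out:
  fixes \<sigma> :: "'a::euclidean_space \<Rightarrow> real"
  assumes "sublinear \<sigma>" "smooth_fun 1 f" "\<And>x. \<sigma> x - width \<sigma> \<le> f x"
  shows "F_out \<sigma> x \<le> f x"
proof -
  obtain grad where g: "\<And>x. GDERIV f x :> grad x" "\<And>x y. norm (grad x - grad y) \<le> norm (x - y)"
    using assms(2) by (auto simp: smooth_fun_def)
  let ?y = "x - grad x"
  have "rho \<sigma> ?y \<le> f x + width \<sigma> - half_sq_norm (grad x)"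
    unfolding rho_def
  proof (rule cSUP_least[OF subdifferential_nonempty[OF assms(1)]])
    fix \<zeta> assume "\<zeta> \<in> subdifferential \<sigma> 0"
    let ?z = "x + (\<zeta> - grad x)"
    have "\<zeta> \<bullet> ?z \<le> \<sigma> ?z"
      using \<open>\<zeta> \<in> _\<close> by (simp add: subdifferential_def sublinear_zero[OF assms(1)])
    also have "\<dots> \<le> f ?z + width \<sigma>" using assms(3)[of ?z] by simp
    also have "f ?z \<le> f x + grad x \<bullet> (\<zeta> - grad x) + half_sq_norm (\<zeta> - grad x)"
      using descent_inequality[OF g, of ?z x] by simp
    finally show "\<zeta> \<bullet> ?y + half_sq_norm \<zeta> \<le> f x + width \<sigma> - half_sq_norm (grad x)"
      by (simp add: half_sq_norm_expand
          inner_commute field_simps)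
  qed
  moreover have "inf_conv (rho \<sigma>) half_sq_norm x \<le> rho \<sigma> ?y + half_sq_norm (x - ?y)"
    by (rule inf_conv_le[of "\<sigma> x" "rho \<sigma>" half_sq_norm x]) (rule F_out_integrand_ge[OF assms(1)])
  ultimately show ?thesis by (simp add: F_out_def)
qed

section \<open>Rescaling\<close>

lemma rescale_mono: "0 < \<eta> \<Longrightarrow> (\<And>x. f x \<le> g x) \<Longrightarrow> rescale \<eta> f x \<le> rescale \<eta> g x"
  by (simp add: rescale_def)

lemma rescale_inverse: "0 < \<eta> \<Longrightarrow> rescale (1 / \<eta>) (rescale \<eta> f) = f"
  by (simp add: rescale_def fun_eq_iff)

lemma rescale_sublinear: "sublinear \<sigma> \<Longrightarrow> 0 < \<eta> \<Longrightarrow> rescale \<eta> \<sigma> = \<sigma>"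
  by (simp add: rescale_def fun_eq_iff sublinear_scale)

lemma rescale_diff: "0 < \<eta> \<Longrightarrow> rescale \<eta> (\<lambda>x. f x - c) x = rescale \<eta> f x - \<eta> * c"
  by (simp add: rescale_def algebra_simps)

lemma rescale_convex:
  assumes "0 < \<eta>" "convex_on UNIV f"
  shows "convex_on UNIV (rescale \<eta> f)"
proof (rule convex_onI)
  fix t :: real and x y assume t: "0 < t" "t < 1"
  have "f (((1 - t) *\<^sub>R x + t *\<^sub>R y) /\<^sub>R \<eta>) \<le> (1 - t) * f (x /\<^sub>R \<eta>) + t * f (y /\<^sub>R \<eta>)"
    using convex_onD[OF assms(2), of t "x /\<^sub>R \<eta>" "y /\<^sub>R \<eta>"] t by (simp add: scaleR_add_right mult.commute)
  then show "rescale \<eta> f ((1 - t) *\<^sub>R x + t *\<^sub>R y) \<le> (1 - t) * rescale \<eta> f x + t * rescale \<eta> f y"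
    using mult_left_mono[OF _ less_imp_le[OF assms(1)]] by (fastforce simp: rescale_def algebra_simps)
qed simp

lemma rescale_smooth:
  assumes "0 < \<eta>" "smooth_fun \<beta> f"
  shows "smooth_fun (\<beta> / \<eta>) (rescale \<eta> f)"
proof -
  obtain grad where g: "\<And>x. GDERIV f x :> grad x" "\<And>x y. norm (grad x - grad y) \<le> \<beta> * norm (x - y)"
    using assms(2) by (auto simp: smooth_fun_def)
  have "GDERIV (rescale \<eta> f) x :> grad (x /\<^sub>R \<eta>)" for x
  proof -
    have "((\<lambda>x. x /\<^sub>R \<eta>) has_derivative (\<lambda>h. h /\<^sub>R \<eta>)) (at x)"
      by (auto intro!: derivative_eq_intros)
    moreover have "(f has_derivative (\<lambda>h. h \<bullet> grad (x /\<^sub>R \<eta>))) (at (x /\<^sub>R \<eta>))"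
      using g(1) by (simp add: gderiv_def)
    ultimately have "((\<lambda>x. f (x /\<^sub>R \<eta>)) has_derivative (\<lambda>h. (h /\<^sub>R \<eta>) \<bullet> grad (x /\<^sub>R \<eta>))) (at x)"
      by (rule has_derivative_compose)
    then have "((\<lambda>x. \<eta> * f (x /\<^sub>R \<eta>)) has_derivative (\<lambda>h. \<eta> * ((h /\<^sub>R \<eta>) \<bullet> grad (x /\<^sub>R \<eta>)))) (at x)"
      by (rule has_derivative_mult_right)
    then show ?thesis
      using assms(1) by (simp add: gderiv_def rescale_def[abs_def] mult.assoc[symmetric])
  qed
  moreover have "norm (grad (x /\<^sub>R \<eta>) - grad (y /\<^sub>R \<eta>)) \<le> \<beta> / \<eta> * norm (x - y)" for x y
  proof -
    have "norm (x /\<^sub>R \<eta> - y /\<^sub>R \<eta>) = norm (x - y) / \<eta>"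
      using assms(1) by (simp add: scaleR_diff_right[symmetric] divide_inverse mult.commute
          del: scaleR_diff_right)
    then show ?thesis using g(2)[of "x /\<^sub>R \<eta>" "y /\<^sub>R \<eta>"] by simp
  qed
  ultimately show ?thesis
    unfolding smooth_fun_def by (intro exI[of _ "\<lambda>x. grad (x /\<^sub>R \<eta>)"]) simp
qed

section \<open>Optimal smoothings\<close>

lemma fun_dist_minorant_le_iff:
  assumes "\<And>x. f x \<le> \<sigma> x"
  shows "fun_dist \<sigma> f \<le> ereal d \<longleftrightarrow> (\<forall>x. \<sigma> x - d \<le> f x)"
  using assms by (auto simp: fun_dist_def SUP_le_iff abs_of_nonneg algebra_simps)

lemma fun_dist_commute: "fun_dist f g = fun_dist g f"
  by (simp add: fun_dist_def abs_minus_commute)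

text \<open>This is \<open>width_le_gap\<close> for the rescaled function. The distance may be infinite, so the argument runs through a real
  number strictly between a too small distance and the claimed bound.\<close>

lemma fun_dist_minorant_ge:
  fixes \<sigma> :: "'a::euclidean_space \<Rightarrow> real"
  assumes "sublinear \<sigma>" "0 < \<beta>" "smooth_fun \<beta> f" "\<And>x. f x \<le> \<sigma> x"
  shows "ereal (width \<sigma> / \<beta>) \<le> fun_dist \<sigma> f"
proof (rule ccontr)
  assume "\<not> ?thesis"
  then obtain d where d: "fun_dist \<sigma> f \<le> ereal d" "d < width \<sigma> / \<beta>"
    using ereal_dense2[of "fun_dist \<sigma> f" "ereal (width \<sigma> / \<beta>)"]
    by (metis not_le less_imp_le less_ereal.simps(1))
  then have "\<sigma> x - d \<le> f x" for x using fun_dist_minorant_le_iff[of f \<sigma> d, OF assms(4)] by blast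
  then have "\<sigma> x - \<beta> * d \<le> rescale \<beta> f x" for x
    using rescale_mono[OF assms(2), of "\<lambda>x. \<sigma> x - d" f x] assms(1,2)
    by (simp add: rescale_diff rescale_sublinear)
  moreover have "rescale \<beta> f x \<le> \<sigma> x" for x
    using rescale_mono[OF assms(2), of f \<sigma> x] assms by (simp add: rescale_sublinear)
  moreover have "smooth_fun 1 (rescale \<beta> f)"
    using rescale_smooth[OF assms(2,3)] assms(2) by simp
  ultimately have "width \<sigma> \<le> \<beta> * d" by (intro width_le_gap[OF assms(1)])
  then show False using d(2) assms(2) by (simp add: field_simps)
qed

lemma rescaled_f_out_smoothing:
  fixes \<sigma> :: "'a::euclidean_space \<Rightarrow> real"
  assumes "sublinear \<sigma>" "0 < \<beta>"
  shows "smooth_fun \<beta> (rescale (1 / \<beta>) (f_out \<sigma>))" "convex_on UNIV (rescale (1 / \<beta>) (f_out \<sigma>))"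
    and "\<And>x. rescale (1 / \<beta>) (f_out \<sigma>) x \<le> \<sigma> x"
    and "fun_dist \<sigma> (rescale (1 / \<beta>) (f_out \<sigma>)) \<le> ereal (width \<sigma> / \<beta>)"
proof -
  have \<beta>: "0 < 1 / \<beta>" using assms(2) by simp
  note f = f_out_convex_smooth[OF assms(1)]
  show "smooth_fun \<beta> (rescale (1 / \<beta>) (f_out \<sigma>))" using rescale_smooth[OF \<beta> f(2)] by simp
  show "convex_on UNIV (rescale (1 / \<beta>) (f_out \<sigma>))" using rescale_convex[OF \<beta> f(1)] .
  show le: "rescale (1 / \<beta>) (f_out \<sigma>) x \<le> \<sigma> x" for x
    using rescale_mono[OF \<beta>, of "f_out \<sigma>" \<sigma> x, OF f_out_le[OF assms(1)]] by (simp add: rescale_sublinear[OF assms(1) \<beta>])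
  have "\<sigma> x - width \<sigma> / \<beta> \<le> rescale (1 / \<beta>) (f_out \<sigma>) x" for x
    using rescale_mono[OF \<beta>, of "\<lambda>x. \<sigma> x - width \<sigma>" "f_out \<sigma>" x, OF f_out_ge[OF assms(1)]]
    by (simp add: rescale_sublinear[OF assms(1) \<beta>] rescale_diff[OF \<beta>])
  then show "fun_dist \<sigma> (rescale (1 / \<beta>) (f_out \<sigma>)) \<le> ereal (width \<sigma> / \<beta>)"
    using fun_dist_minorant_le_iff[of "rescale (1 / \<beta>) (f_out \<sigma>)" \<sigma>] le by blast
qed

text \<open>The best possible error \<open>width \<sigma> / \<beta>\<close> is attained by the rescaled \<open>f_out\<close>, so
  an optimal smoothing has to match it.\<close>

lemma optimal_outer_smoothing_iff_gap:
  fixes \<sigma> :: "'a::euclidean_space \<Rightarrow> real"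
  assumes "sublinear \<sigma>" "0 < \<beta>" "smooth_fun \<beta> f" "convex_on UNIV f"
  shows "optimal_outer_smoothing \<beta> \<sigma> f \<longleftrightarrow>
    (\<forall>x. f x \<le> \<sigma> x) \<and> (\<forall>x. \<sigma> x - width \<sigma> / \<beta> \<le> f x)"
proof
  assume "optimal_outer_smoothing \<beta> \<sigma> f"
  then have "\<forall>x. f x \<le> \<sigma> x" "fun_dist \<sigma> f \<le> ereal (width \<sigma> / \<beta>)"
    using rescaled_f_out_smoothing[OF assms(1,2)] order_trans
    unfolding optimal_outer_smoothing_def by blast+
  then show "(\<forall>x. f x \<le> \<sigma> x) \<and> (\<forall>x. \<sigma> x - width \<sigma> / \<beta> \<le> f x)"
    using fun_dist_minorant_le_iff[of f \<sigma>] by blast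
next
  assume R: "(\<forall>x. f x \<le> \<sigma> x) \<and> (\<forall>x. \<sigma> x - width \<sigma> / \<beta> \<le> f x)"
  then have "fun_dist \<sigma> f \<le> ereal (width \<sigma> / \<beta>)" using fun_dist_minorant_le_iff[of f \<sigma>] by blast
  then show "optimal_outer_smoothing \<beta> \<sigma> f"
    using assms R fun_dist_minorant_ge[OF assms(1,2)] order_trans
    unfolding optimal_outer_smoothing_def by blast
qed

lemma gap_iff_between_extremal:
  fixes \<sigma> :: "'a::euclidean_space \<Rightarrow> real"
  assumes "sublinear \<sigma>" "smooth_fun 1 f" "convex_on UNIV f"
  shows "(\<forall>x. f x \<le> \<sigma> x) \<and> (\<forall>x. \<sigma> x - width \<sigma> \<le> f x) \<longleftrightarrow>
    (\<forall>x. F_out \<sigma> x \<le> f x \<and> f x \<le> f_out \<sigma> x)"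
  using optimal_gap_le_f_out[OF assms(1,3,2)] optimal_gap_ge_F_out[OF assms(1,2)]
    f_out_le[OF assms(1)] F_out_ge[OF assms(1)] by (meson order_trans)

lemma rescale_le_iff:
  assumes "0 < \<eta>"
  shows "(\<forall>x. rescale (1 / \<eta>) g x \<le> f x) \<longleftrightarrow> (\<forall>x. g x \<le> rescale \<eta> f x)"
    and "(\<forall>x. f x \<le> rescale (1 / \<eta>) g x) \<longleftrightarrow> (\<forall>x. rescale \<eta> f x \<le> g x)"
proof -
  have inv: "rescale \<eta> (rescale (1 / \<eta>) g) = g" "rescale (1 / \<eta>) (rescale \<eta> f) = f"
    using rescale_inverse[of "1 / \<eta>" g] rescale_inverse[of \<eta> f] assms by simp_all
  note mono = rescale_mono[OF assms, of "rescale (1 / \<eta>) g" f] rescale_mono[OF assms, of f "rescale (1 / \<eta>) g"]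
    rescale_mono[of "1 / \<eta>" g "rescale \<eta> f"] rescale_mono[of "1 / \<eta>" "rescale \<eta> f" g]
  show "(\<forall>x. rescale (1 / \<eta>) g x \<le> f x) \<longleftrightarrow> (\<forall>x. g x \<le> rescale \<eta> f x)"
    and "(\<forall>x. f x \<le> rescale (1 / \<eta>) g x) \<longleftrightarrow> (\<forall>x. rescale \<eta> f x \<le> g x)"
    using mono assms unfolding inv by auto
qed

theorem theorem4p5:
  fixes \<sigma> :: "'a::euclidean_space \<Rightarrow> real"
  assumes "sublinear \<sigma>"
  shows "(\<forall>l::real. outer_smoothable l \<sigma> \<longleftrightarrow> l \<ge> width \<sigma>) \<and>
         (\<forall>\<beta>>0. \<forall>f::'a \<Rightarrow> real. smooth_fun \<beta> f \<and> convex_on UNIV f \<longrightarrow>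
            (optimal_outer_smoothing \<beta> \<sigma> f \<longleftrightarrow>
              (\<forall>x. rescale (1 / \<beta>) (F_out \<sigma>) x \<le> f x \<and> f x \<le> rescale (1 / \<beta>) (f_out \<sigma>) x)))"
proof (intro conjI allI impI)
  fix l :: real
  show "outer_smoothable l \<sigma> \<longleftrightarrow> l \<ge> width \<sigma>"
  proof
    assume "outer_smoothable l \<sigma>"
    then obtain f where f: "smooth_fun 1 f" "\<And>x. f x \<le> \<sigma> x" "fun_dist \<sigma> f \<le> ereal l"
      unfolding outer_smoothable_def fun_dist_commute[of _ \<sigma>] by (metis div_by_1 zero_less_one)
    then show "l \<ge> width \<sigma>"
      using fun_dist_minorant_ge[OF assms, of 1 f] order_trans by fastforce
  next
    assume l: "l \<ge> width \<sigma>"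
    show "outer_smoothable l \<sigma>"
      unfolding outer_smoothable_def
    proof (intro allI impI)
      fix \<beta> :: real assume \<beta>: "0 < \<beta>"
      note f = rescaled_f_out_smoothing[OF assms \<beta>]
      have "fun_dist (rescale (1 / \<beta>) (f_out \<sigma>)) \<sigma> \<le> ereal (l / \<beta>)"
        using f(4) l \<beta> unfolding fun_dist_commute[of _ \<sigma>]
        by (elim order_trans) (simp add: divide_right_mono)
      then show "\<exists>f. smooth_fun \<beta> f \<and> convex_on UNIV f \<and> (\<forall>x. f x \<le> \<sigma> x) \<and>
          fun_dist f \<sigma> \<le> ereal (l / \<beta>)"
        using f by blast
    qed
  qed
next
  fix \<beta> :: real and f :: "'a \<Rightarrow> real"
  assume \<beta>: "0 < \<beta>" and f: "smooth_fun \<beta> f \<and> convex_on UNIV f"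
  have \<sigma>: "rescale (1 / \<beta>) \<sigma> = \<sigma>"
    "rescale (1 / \<beta>) (\<lambda>x. \<sigma> x - width \<sigma>) = (\<lambda>x. \<sigma> x - width \<sigma> / \<beta>)"
    using assms \<beta> by (simp_all add: rescale_sublinear rescale_diff fun_eq_iff)
  have "optimal_outer_smoothing \<beta> \<sigma> f \<longleftrightarrow>
      (\<forall>x. f x \<le> \<sigma> x) \<and> (\<forall>x. \<sigma> x - width \<sigma> / \<beta> \<le> f x)"
    using optimal_outer_smoothing_iff_gap[OF assms \<beta>] f by blast
  also have "\<dots> \<longleftrightarrow> (\<forall>x. rescale \<beta> f x \<le> \<sigma> x) \<and> (\<forall>x. \<sigma> x - width \<sigma> \<le> rescale \<beta> f x)"
    using rescale_le_iff(2)[OF \<beta>, of f \<sigma>] rescale_le_iff(1)[OF \<beta>, of "\<lambda>x. \<sigma> x - width \<sigma>" f]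
    unfolding \<sigma> by blast
  also have "\<dots> \<longleftrightarrow> (\<forall>x. F_out \<sigma> x \<le> rescale \<beta> f x \<and> rescale \<beta> f x \<le> f_out \<sigma> x)"
    using rescale_smooth[OF \<beta>, of \<beta> f] rescale_convex[OF \<beta>, of f] f \<beta>
    by (intro gap_iff_between_extremal[OF assms]) auto
  also have "\<dots> \<longleftrightarrow> (\<forall>x. rescale (1 / \<beta>) (F_out \<sigma>) x \<le> f x \<and> f x \<le> rescale (1 / \<beta>) (f_out \<sigma>) x)"
    using rescale_le_iff[OF \<beta>, where f = f] by blast
  finally show "optimal_outer_smoothing \<beta> \<sigma> f \<longleftrightarrow>
      (\<forall>x. rescale (1 / \<beta>) (F_out \<sigma>) x \<le> f x \<and> f x \<le> rescale (1 / \<beta>) (f_out \<sigma>) x)" .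
qed

end
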